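(* $\mathsf{IVT}\equiv_{sW}\mathsf{C_I}$.
   Context: A represented space is a pair $(X,\delta_X)$ with $\delta_X:\subseteq\mathbb N^{\mathbb N}\to X$ a partial surjection. For a partial multi-valued map $f:\subseteq X\rightrightarrows Y$, a realizer of $f$ is a partial $F:\subseteq\mathbb N^{\mathbb N}\to\mathbb N^{\mathbb N}$ with $\delta_Y(F(p))\in f(\delta_X(p))$ for all $p\in\mathrm{dom}(f\circ\delta_X)$. $f\le_{sW}g$ (strong Weihrauch reducibility) means there are computable partial $H,K:\subseteq\mathbb N^{\mathbb N}\to\mathbb N^{\mathbb N}$ such that $H\circ G\circ K$ is a realizer of $f$ for every realizer $G$ of $g$; $\equiv_{sW}$ is the induced equivalence. $\mathcal A_-([0,1])$ is the set of closed subsets of $[0,1]$, where a name of $A$ is an enumeration of rational open intervals (open in $[0,1]$) whose union is $[0,1]\setminus A$. $\mathsf{C_I}:\subseteq\mathcal A_-([0,1])\rightrightarrows[0,1]$, $A\mapsto A$, defined on intervals $[a,b]$ with $0\le a\le b\le1$. $\mathcal C[0,1]$ is the space of continuous $f:[0,1]\to\mathbb R$ with its standard (function space / Cauchy) representation; reals use the Cauchy representation. $\mathsf{IVT}:\subseteq\mathcal C[0,1]\rightrightarrows[0,1]$, $f\mapsto\{x\in[0,1]:f(x)=0\}$, defined for $f$ with $f(0)\cdot f(1)<0$. *)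

theory Defs
  imports "HOL-Analysis.Analysis" "HOL-Library.Nat_Bijection"
begin

type_synonym baire = "nat \<Rightarrow> nat"

datatype recf = Zero | Succ | Proj nat | Oracle
  | Comp recf "recf list" | PrimRec recf recf | Mn recf

inductive ev :: "baire \<Rightarrow> recf \<Rightarrow> nat list \<Rightarrow> nat \<Rightarrow> bool" for p :: baire where
  ev_zero: "ev p Zero xs 0"
| ev_succ: "ev p Succ (x # xs) (Suc x)"
| ev_proj: "i < length xs \<Longrightarrow> ev p (Proj i) xs (xs ! i)"
| ev_oracle: "ev p Oracle (x # xs) (p x)"
| ev_comp: "length ys = length gs \<Longrightarrow> (\<forall>i<length gs. ev p (gs ! i) xs (ys ! i))
            \<Longrightarrow> ev p f ys z \<Longrightarrow> ev p (Comp f gs) xs z"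
| ev_pr0: "ev p f xs y \<Longrightarrow> ev p (PrimRec f g) (0 # xs) y"
| ev_prS: "ev p (PrimRec f g) (n # xs) y \<Longrightarrow> ev p g (n # y # xs) z
            \<Longrightarrow> ev p (PrimRec f g) (Suc n # xs) z"
| ev_mn: "ev p f (n # xs) 0 \<Longrightarrow> (\<forall>m<n. \<exists>y. 0 < y \<and> ev p f (m # xs) y)
            \<Longrightarrow> ev p (Mn f) xs n"

text \<open>A partial map F on Baire space (None = undefined) is computable iff some
  oracle machine e computes, for every p in dom F, every digit of F p
  (i.e. F has a computable extension; this is type-2 computability).\<close>
definition computable :: "(baire \<Rightarrow> baire option) \<Rightarrow> bool" where
  "computable F \<longleftrightarrow> (\<exists>e. \<forall>p q. F p = Some q \<longrightarrow> (\<forall>n. ev p e [n] (q n)))"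

text \<open>A representation is given as a (single-valued) naming relation
  \<delta> p x meaning "p \<in> dom \<delta> and \<delta>(p) = x". A partial multi-valued map is a
  domain D together with a set-valued map f.\<close>

definition realizer ::
  "(baire \<Rightarrow> 'a \<Rightarrow> bool) \<Rightarrow> (baire \<Rightarrow> 'b \<Rightarrow> bool) \<Rightarrow> 'a set \<Rightarrow> ('a \<Rightarrow> 'b set)
     \<Rightarrow> (baire \<Rightarrow> baire option) \<Rightarrow> bool" where
  "realizer \<delta>X \<delta>Y D f F \<longleftrightarrow>
     (\<forall>p x. \<delta>X p x \<longrightarrow> x \<in> D \<longrightarrow> (\<exists>q y. F p = Some q \<and> \<delta>Y q y \<and> y \<in> f x))"

definition sW_le ::
  "(baire \<Rightarrow> 'a \<Rightarrow> bool) \<Rightarrow> (baire \<Rightarrow> 'b \<Rightarrow> bool) \<Rightarrow> 'a set \<Rightarrow> ('a \<Rightarrow> 'b set)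
   \<Rightarrow> (baire \<Rightarrow> 'c \<Rightarrow> bool) \<Rightarrow> (baire \<Rightarrow> 'd \<Rightarrow> bool) \<Rightarrow> 'c set \<Rightarrow> ('c \<Rightarrow> 'd set)
   \<Rightarrow> bool" where
  "sW_le \<delta>X \<delta>Y Df f \<delta>U \<delta>V Dg g \<longleftrightarrow>
     (\<exists>H K. computable H \<and> computable K \<and>
        (\<forall>G. realizer \<delta>U \<delta>V Dg g G \<longrightarrow>
              realizer \<delta>X \<delta>Y Df f (\<lambda>p. Option.bind (Option.bind (K p) G) H)))"

definition sW_equiv ::
  "(baire \<Rightarrow> 'a \<Rightarrow> bool) \<Rightarrow> (baire \<Rightarrow> 'b \<Rightarrow> bool) \<Rightarrow> 'a set \<Rightarrow> ('a \<Rightarrow> 'b set)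
   \<Rightarrow> (baire \<Rightarrow> 'c \<Rightarrow> bool) \<Rightarrow> (baire \<Rightarrow> 'd \<Rightarrow> bool) \<Rightarrow> 'c set \<Rightarrow> ('c \<Rightarrow> 'd set)
   \<Rightarrow> bool" where
  "sW_equiv \<delta>X \<delta>Y Df f \<delta>U \<delta>V Dg g \<longleftrightarrow>
     sW_le \<delta>X \<delta>Y Df f \<delta>U \<delta>V Dg g \<and> sW_le \<delta>U \<delta>V Dg g \<delta>X \<delta>Y Df f"

definition qdec :: "nat \<Rightarrow> real" where
  "qdec n = (case prod_decode n of (a, b) \<Rightarrow> real_of_int (int_decode a) / real (Suc b))"

definition unit_rep :: "baire \<Rightarrow> real \<Rightarrow> bool" where
  "unit_rep p x \<longleftrightarrow> x \<in> {0..1} \<and> (\<forall>n. \<bar>qdec (p n) - x\<bar> \<le> (1/2) ^ n)"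

definition qpoly :: "nat \<Rightarrow> real \<Rightarrow> real" where
  "qpoly k x = (let cs = list_decode k in (\<Sum>i<length cs. qdec (cs ! i) * x ^ i))"

text \<open>Cauchy representation of C[0,1] (dense set: rational polynomials, sup-metric).
  Elements of C[0,1] are continuous functions on [0,1], made unique by
  requiring them to be extensional on [0,1].\<close>
definition cfun_rep :: "baire \<Rightarrow> (real \<Rightarrow> real) \<Rightarrow> bool" where
  "cfun_rep p f \<longleftrightarrow> f \<in> extensional {0..1} \<and> continuous_on {0..1} f \<and>
     (\<forall>n. \<forall>x\<in>{0..1}. \<bar>qpoly (p n) x - f x\<bar> \<le> (1/2) ^ n)"

definition qint :: "nat \<Rightarrow> real set" where
  "qint k = (case prod_decode k of (a, b) \<Rightarrow> {x\<in>{0..1}. qdec a < x \<and> x < qdec b})"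

text \<open>Negative information representation of A_-([0,1]): p n = 0 means "no interval",
  p n = Suc k enumerates qint k; the union of the enumerated intervals is [0,1] - A.\<close>
definition closed_rep :: "baire \<Rightarrow> real set \<Rightarrow> bool" where
  "closed_rep p A \<longleftrightarrow> A \<subseteq> {0..1} \<and> closed A \<and>
     {0..1} - A = (\<Union>n\<in>{n. p n \<noteq> 0}. qint (p n - 1))"

definition CI_dom :: "real set set" where
  "CI_dom = {A. \<exists>a b. 0 \<le> a \<and> a \<le> b \<and> b \<le> 1 \<and> A = {a..b}}"

definition CI_map :: "real set \<Rightarrow> real set" where
  "CI_map A = A"

definition IVT_dom :: "(real \<Rightarrow> real) set" where
  "IVT_dom = {f. f \<in> extensional {0..1} \<and> continuous_on {0..1} f \<and> f 0 * f 1 < 0}"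

definition IVT_map :: "(real \<Rightarrow> real) \<Rightarrow> real set" where
  "IVT_map f = {x\<in>{0..1}. f x = 0}"

end

theory Submission
  imports Defs
begin

text \<open>For IVT \<le> C_I, keep rationals a < b with f(a), f(b) confirmed nonzero of opposite signs, and
  replace one of them by every rational between them at which f is eventually confirmed nonzero.
  In the limit f vanishes on the interval [lim a, lim b], whose complement is enumerated by the
  approximations.

  For C_I \<le> IVT, swallowing enumerated intervals greedily from both ends of [0,1] yields
  rationals l_m increasing to a and r_m decreasing to b. The function
  \<Sum>m. 2^-m (max 0 (y - r_m) - max 0 (l_m - y)) is negative left of a, zero exactly on [a,b] and
  positive right of b. Since its partial sums are uniformly Lipschitz, explicit
  Bernstein polynomials provide the required rational polynomials. All maps involved are
  primitive recursive in the oracle.\<close>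

section \<open>Functions recursive in an oracle\<close>

text \<open>One program \<open>e\<close> has to serve every oracle, so that a total functional of
  this kind yields a computable map on Baire space.\<close>

definition rec_fun :: "nat \<Rightarrow> (baire \<Rightarrow> nat list \<Rightarrow> nat) \<Rightarrow> bool" where
  "rec_fun k F \<longleftrightarrow> (\<exists>e. \<forall>p xs. length xs = k \<longrightarrow> ev p e xs (F p xs))"

named_theorems rec_fun_intros

lemma rec_fun_comp:
  assumes "rec_fun (length Gs) F" and "\<And>G. G \<in> set Gs \<Longrightarrow> rec_fun k G"
  shows "rec_fun k (\<lambda>p xs. F p (map (\<lambda>G. G p xs) Gs))"
proof -
  obtain e where e: "\<And>p ys. length ys = length Gs \<Longrightarrow> ev p e ys (F p ys)"
    using assms(1) by (auto simp: rec_fun_def)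
  obtain c where c: "\<And>G p xs. G \<in> set Gs \<Longrightarrow> length xs = k \<Longrightarrow> ev p (c G) xs (G p xs)"
    using assms(2) unfolding rec_fun_def by metis
  have "ev p (Comp e (map c Gs)) xs (F p (map (\<lambda>G. G p xs) Gs))" if "length xs = k" for p xs
    by (rule ev_comp[where ys = "map (\<lambda>G. G p xs) Gs"]) (use that c e in auto)
  then show ?thesis
    unfolding rec_fun_def by blast
qed

lemma rec_fun_comp1:
  assumes "rec_fun 1 (\<lambda>p xs. F p (xs ! 0))" and "rec_fun k A"
  shows "rec_fun k (\<lambda>p xs. F p (A p xs))"
  using rec_fun_comp[of "[A]" "\<lambda>p xs. F p (xs ! 0)" k] assms by simp

lemma rec_fun_proj [rec_fun_intros]: "i < k \<Longrightarrow> rec_fun k (\<lambda>p xs. xs ! i)"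
  unfolding rec_fun_def by (rule exI[of _ "Proj i"]) (auto intro: ev_proj)

lemma rec_fun_zero [rec_fun_intros]: "rec_fun k (\<lambda>p xs. 0)"
  unfolding rec_fun_def by (rule exI[of _ Zero]) (auto intro: ev_zero)

lemma rec_fun_Suc [rec_fun_intros]:
  assumes "rec_fun k A"
  shows "rec_fun k (\<lambda>p xs. Suc (A p xs))"
proof -
  have "rec_fun 1 (\<lambda>p xs. Suc (xs ! 0))"
    unfolding rec_fun_def by (rule exI[of _ Succ]) (auto simp: length_Suc_conv intro: ev_succ)
  then show ?thesis
    using assms by (rule rec_fun_comp1)
qed

lemma rec_fun_oracle [rec_fun_intros]:
  assumes "rec_fun k A"
  shows "rec_fun k (\<lambda>p xs. p (A p xs))"
proof -
  have "rec_fun 1 (\<lambda>p xs. p (xs ! 0))"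
    unfolding rec_fun_def by (rule exI[of _ Oracle]) (auto simp: length_Suc_conv intro: ev_oracle)
  then show ?thesis
    using assms by (rule rec_fun_comp1)
qed

lemma rec_fun_rec_nat [rec_fun_intros]:
  assumes F: "rec_fun k F" and G: "rec_fun (Suc (Suc k)) (\<lambda>p ys. G p (ys ! 0) (ys ! 1) (drop 2 ys))"
    and N: "rec_fun k N"
  shows "rec_fun k (\<lambda>p xs. rec_nat (F p xs) (\<lambda>n y. G p n y xs) (N p xs))"
proof -
  obtain f where f: "\<And>p xs. length xs = k \<Longrightarrow> ev p f xs (F p xs)"
    using F by (auto simp: rec_fun_def)
  obtain g where g: "\<And>p xs. length xs = Suc (Suc k) \<Longrightarrow> ev p g xs (G p (xs ! 0) (xs ! 1) (drop 2 xs))"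
    using G by (auto simp: rec_fun_def)
  have "ev p (PrimRec f g) (n # xs) (rec_nat (F p xs) (\<lambda>n y. G p n y xs) n)" if "length xs = k" for p xs n
  proof (induction n)
    case 0
    then show ?case using f[OF that] by (auto intro: ev_pr0)
  next
    case (Suc n)
    show ?case
      using ev_prS[OF Suc] g[of "n # _ # xs" p] that by simp
  qed
  then have "rec_fun (Suc k) (\<lambda>p ys. rec_nat (F p (tl ys)) (\<lambda>n y. G p n y (tl ys)) (ys ! 0))"
    unfolding rec_fun_def by (intro exI[of _ "PrimRec f g"]) (auto simp: length_Suc_conv)
  \<comment> \<open>\<open>PrimRec\<close> recurses on an additional first argument; composing with
    \<open>N\<close> in that place and with projections in the others restores the arity
    \<open>k\<close>.\<close>
  moreover have "rec_fun k G" if "G \<in> set (N # map (\<lambda>i p xs. xs ! i) [0..<k])" for G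
    using that N by (auto intro: rec_fun_proj)
  ultimately have "rec_fun k (\<lambda>p xs. rec_nat (F p (map (\<lambda>i. xs ! i) [0..<k]))
      (\<lambda>n y. G p n y (map (\<lambda>i. xs ! i) [0..<k])) (N p xs))"
    using rec_fun_comp[of "N # map (\<lambda>i p xs. xs ! i) [0..<k]"
      "\<lambda>p ys. rec_nat (F p (tl ys)) (\<lambda>n y. G p n y (tl ys)) (ys ! 0)" k]
    by (simp add: comp_def)
  moreover have "map (\<lambda>i. xs ! i) [0..<k] = xs" if "length xs = k" for xs :: "nat list"
    using that map_nth by blast
  ultimately show ?thesis
    by (simp add: rec_fun_def)
qed

lemma rec_fun_add [rec_fun_intros]:
  assumes "rec_fun k A" "rec_fun k B"
  shows "rec_fun k (\<lambda>p xs. A p xs + B p xs)"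
proof -
  have "A p xs + B p xs = rec_nat (A p xs) (\<lambda>n y. Suc y) (B p xs)" for p xs
    by (induction "B p xs" arbitrary: B) (auto, metis add_Suc_right old.nat.simps(7))
  then show ?thesis
    by (simp only:) (intro rec_fun_intros assms, simp)
qed

lemma rec_fun_pred:
  assumes "rec_fun k A"
  shows "rec_fun k (\<lambda>p xs. A p xs - 1)"
proof -
  have "a - 1 = rec_nat 0 (\<lambda>n y. n) a" for a :: nat
    by (cases a) auto
  then show ?thesis
    by (simp only:) (intro rec_fun_intros assms, simp)
qed

lemma rec_fun_diff [rec_fun_intros]:
  assumes "rec_fun k A" "rec_fun k B"
  shows "rec_fun k (\<lambda>p xs. A p xs - B p xs)"
proof -
  have eq: "rec_nat a (\<lambda>n y. y - 1) b = a - b" for a b :: nat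
    by (induction b) auto
  have "rec_fun k (\<lambda>p xs. rec_nat (A p xs) (\<lambda>n y. y - 1) (B p xs))"
    by (intro rec_fun_intros rec_fun_pred assms) simp
  then show ?thesis
    by (simp only: eq)
qed

section \<open>The Cantor pairing and its inverse\<close>

lemma rec_fun_triangle [rec_fun_intros]:
  assumes "rec_fun k A"
  shows "rec_fun k (\<lambda>p xs. triangle (A p xs))"
proof -
  have "triangle a = rec_nat 0 (\<lambda>n y. Suc (y + n)) a" for a :: nat
    by (induction a) auto
  then show ?thesis
    by (simp only:) (intro rec_fun_intros assms, auto)
qed

lemma rec_fun_pair:
  assumes "rec_fun k A" "rec_fun k B"
  shows "rec_fun k (\<lambda>p xs. prod_encode (A p xs, B p xs))"
  by (simp add: prod_encode_def) (intro rec_fun_intros assms)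

text \<open>The index of the diagonal of the Cantor pairing on which \<open>n\<close> lies, that is,
  the sum of the two components of \<open>n\<close>. The truncated difference adds 1 exactly when
  \<open>triangle (Suc s) \<le> Suc n\<close>.\<close>

definition triangle_root :: "nat \<Rightarrow> nat" where
  "triangle_root = rec_nat 0 (\<lambda>n s. s + (Suc 0 - (triangle (Suc s) - Suc n)))"

lemma triangle_root_bounds: "triangle (triangle_root n) \<le> n" "n < triangle (Suc (triangle_root n))"
proof (induction n)
  case (Suc n)
  have step: "triangle_root (Suc n) = (let s = triangle_root n in s + (Suc 0 - (triangle (Suc s) - Suc n)))"
    by (simp add: triangle_root_def Let_def)
  { case 1
    show ?case
      using Suc by (cases "triangle (Suc (triangle_root n)) \<le> Suc n") (auto simp: step Let_def simp del: triangle_Suc)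
  next
    case 2
    show ?case
      using Suc by (cases "triangle (Suc (triangle_root n)) \<le> Suc n") (auto simp: step Let_def)
  }
qed (auto simp: triangle_root_def)

lemma prod_decode_root:
  "prod_decode n = (n - triangle (triangle_root n), triangle_root n - (n - triangle (triangle_root n)))"
proof -
  have "prod_encode (n - triangle (triangle_root n), triangle_root n - (n - triangle (triangle_root n))) = n"
    using triangle_root_bounds[of n] by (simp add: prod_encode_def)
  then show ?thesis
    by (metis prod_encode_inverse)
qed

lemma rec_fun_triangle_root [rec_fun_intros]:
  assumes "rec_fun k A"
  shows "rec_fun k (\<lambda>p xs. triangle_root (A p xs))"
  unfolding triangle_root_def by (intro rec_fun_intros assms) auto

lemma rec_fun_fst_snd:
  assumes "rec_fun k A"
  shows "rec_fun k (\<lambda>p xs. fst (prod_decode (A p xs)))" "rec_fun k (\<lambda>p xs. snd (prod_decode (A p xs)))"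
  by (simp_all only: prod_decode_root fst_conv snd_conv) (intro rec_fun_intros assms)+

text \<open>From here on all functions are unary, several arguments being coded into one by
  prod_encode.\<close>

definition comp_nat :: "(baire \<Rightarrow> nat \<Rightarrow> nat) \<Rightarrow> bool" where
  "comp_nat F \<longleftrightarrow> rec_fun 1 (\<lambda>p xs. F p (xs ! 0))"

abbreviation nfst :: "nat \<Rightarrow> nat" where "nfst n \<equiv> fst (prod_decode n)"
abbreviation nsnd :: "nat \<Rightarrow> nat" where "nsnd n \<equiv> snd (prod_decode n)"

definition comp_pred :: "(baire \<Rightarrow> nat \<Rightarrow> bool) \<Rightarrow> bool" where
  "comp_pred P \<longleftrightarrow> comp_nat (\<lambda>p x. of_bool (P p x))"

named_theorems comp_intros

lemma comp_nat_compose: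
  assumes "comp_nat F" "comp_nat A"
  shows "comp_nat (\<lambda>p x. F p (A p x))"
  using rec_fun_comp[of "[\<lambda>p xs. A p (xs ! 0)]" "\<lambda>p xs. F p (xs ! 0)" 1] assms
  by (simp add: comp_nat_def)

lemma comp_nat_const [comp_intros]: "comp_nat (\<lambda>p x. c)"
  unfolding comp_nat_def by (induction c) (auto intro: rec_fun_intros)

lemma comp_nat_basic [comp_intros]:
  shows comp_nat_id: "comp_nat (\<lambda>p x. x)"
    and comp_nat_Suc: "comp_nat A \<Longrightarrow> comp_nat (\<lambda>p x. Suc (A p x))"
    and comp_nat_oracle: "comp_nat A \<Longrightarrow> comp_nat (\<lambda>p x. p (A p x))"
    and comp_nat_add: "comp_nat A \<Longrightarrow> comp_nat B \<Longrightarrow> comp_nat (\<lambda>p x. A p x + B p x)"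
    and comp_nat_diff: "comp_nat A \<Longrightarrow> comp_nat B \<Longrightarrow> comp_nat (\<lambda>p x. A p x - B p x)"
    and comp_nat_pair: "comp_nat A \<Longrightarrow> comp_nat B \<Longrightarrow> comp_nat (\<lambda>p x. prod_encode (A p x, B p x))"
    and comp_nat_fst: "comp_nat A \<Longrightarrow> comp_nat (\<lambda>p x. nfst (A p x))"
    and comp_nat_snd: "comp_nat A \<Longrightarrow> comp_nat (\<lambda>p x. nsnd (A p x))"
  by (auto simp: comp_nat_def intro: rec_fun_intros rec_fun_pair rec_fun_fst_snd)

text \<open>Counter, previous value and parameter reach the step function in one code, so that step
  functions fall under the same unary rules.\<close>

lemma comp_nat_rec [comp_intros]:
  assumes B: "comp_nat B" and G: "comp_nat (\<lambda>p e. G p (nfst e) (nfst (nsnd e)) (nsnd (nsnd e)))"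
    and N: "comp_nat N"
  shows "comp_nat (\<lambda>p x. rec_nat (B p x) (\<lambda>n y. G p n y x) (N p x))"
proof -
  let ?code = "\<lambda>p ys. prod_encode (ys ! 0, prod_encode (ys ! 1, ys ! 2))"
  have "rec_fun 3 ?code"
    by (intro rec_fun_pair rec_fun_intros) auto
  then have "rec_fun 3 (\<lambda>p ys. G p (ys ! 0) (ys ! 1) (ys ! 2))"
    using rec_fun_comp[of "[?code]" "\<lambda>p xs. G p (nfst (xs ! 0)) (nfst (nsnd (xs ! 0))) (nsnd (nsnd (xs ! 0)))" 3] G
    by (simp add: comp_nat_def)
  then have "rec_fun (Suc (Suc 1)) (\<lambda>p ys. G p (ys ! 0) (ys ! 1) (drop 2 ys ! 0))"
    by (simp add: rec_fun_def numeral_3_eq_3)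
  then show ?thesis
    using B N unfolding comp_nat_def by (intro rec_fun_rec_nat)
qed

lemma comp_nat_compose2:
  assumes "comp_nat (\<lambda>p e. F p (nfst e) (nsnd e))" "comp_nat A" "comp_nat B"
  shows "comp_nat (\<lambda>p x. F p (A p x) (B p x))"
  using comp_nat_compose[OF assms(1) comp_nat_pair[OF assms(2,3)]] by simp

section \<open>Arithmetic and decisions on natural numbers\<close>

lemma comp_nat_mult [comp_intros]:
  assumes "comp_nat A" "comp_nat B"
  shows "comp_nat (\<lambda>p x. A p x * B p x)"
proof -
  have "a * b = rec_nat 0 (\<lambda>n y. y + a) b" for a b :: nat
    by (induction b) auto
  \<comment> \<open>Inside the step function the parameter is \<open>nsnd (nsnd e)\<close>, hence
    the composition of \<open>A\<close> with a projection.\<close>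
  then show ?thesis
    by (simp only:) (intro comp_intros comp_nat_compose[OF assms(1)] assms)
qed

lemma comp_nat_power [comp_intros]:
  assumes "comp_nat A" "comp_nat B"
  shows "comp_nat (\<lambda>p x. A p x ^ B p x)"
proof -
  have "a ^ b = rec_nat 1 (\<lambda>n y. y * a) b" for a b :: nat
    by (induction b) auto
  then show ?thesis
    by (simp only:) (intro comp_intros comp_nat_compose[OF assms(1)] assms)
qed

lemma comp_nat_fact [comp_intros]:
  assumes "comp_nat A"
  shows "comp_nat (\<lambda>p x. fact (A p x))"
proof -
  have "fact a = rec_nat 1 (\<lambda>n y. y * Suc n) a" for a :: nat
    by (induction a) auto
  then show ?thesis
    by (simp only:) (intro comp_intros assms)
qed

lemma comp_pred_even [comp_intros]:
  assumes "comp_nat A"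
  shows "comp_pred (\<lambda>p x. even (A p x))"
proof -
  have "of_bool (even a) = rec_nat (1::nat) (\<lambda>n y. 1 - y) a" for a :: nat
    by (induction a) auto
  then show ?thesis
    unfolding comp_pred_def by (simp only:) (intro comp_intros assms)
qed

lemma comp_nat_div2 [comp_intros]:
  assumes "comp_nat A"
  shows "comp_nat (\<lambda>p x. A p x div 2)"
proof -
  have "a div 2 = rec_nat 0 (\<lambda>n y. y + (1 - of_bool (even n))) a" for a :: nat
    by (induction a) auto
  moreover have "comp_nat (\<lambda>p x. of_bool (even (nfst x)))"
    using comp_pred_even[OF comp_nat_fst[OF comp_nat_id]] by (simp add: comp_pred_def)
  ultimately show ?thesis
    by (simp only:) (intro comp_intros assms)
qed

lemma comp_pred_basic [comp_intros]:
  shows comp_pred_not: "comp_pred P \<Longrightarrow> comp_pred (\<lambda>p x. \<not> P p x)"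
    and comp_pred_conj: "comp_pred P \<Longrightarrow> comp_pred Q \<Longrightarrow> comp_pred (\<lambda>p x. P p x \<and> Q p x)"
    and comp_pred_le: "comp_nat A \<Longrightarrow> comp_nat B \<Longrightarrow> comp_pred (\<lambda>p x. A p x \<le> B p x)"
    and comp_pred_less: "comp_nat A \<Longrightarrow> comp_nat B \<Longrightarrow> comp_pred (\<lambda>p x. A p x < B p x)"
    and comp_pred_eq: "comp_nat A \<Longrightarrow> comp_nat B \<Longrightarrow> comp_pred (\<lambda>p x. A p x = B p x)"
proof -
  have "of_bool (\<not> P) = 1 - (of_bool P :: nat)" for P
    by simp
  then show neg: "comp_pred P \<Longrightarrow> comp_pred (\<lambda>p x. \<not> P p x)" for P
    unfolding comp_pred_def by (simp only:) (intro comp_intros)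
  show conj: "comp_pred P \<Longrightarrow> comp_pred Q \<Longrightarrow> comp_pred (\<lambda>p x. P p x \<and> Q p x)" for P Q
    unfolding comp_pred_def of_bool_conj by (intro comp_intros)
  have "of_bool (a \<le> b) = 1 - (a - b)" for a b :: nat
    by auto
  then show le: "comp_nat A \<Longrightarrow> comp_nat B \<Longrightarrow> comp_pred (\<lambda>p x. A p x \<le> B p x)" for A B
    unfolding comp_pred_def by (simp only:) (intro comp_intros)
  show "comp_nat A \<Longrightarrow> comp_nat B \<Longrightarrow> comp_pred (\<lambda>p x. A p x < B p x)"
    unfolding linorder_not_le[symmetric] by (intro neg le)
  show "comp_nat A \<Longrightarrow> comp_nat B \<Longrightarrow> comp_pred (\<lambda>p x. A p x = B p x)"
    unfolding order_eq_iff by (intro conj le)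
qed

lemma comp_nat_if [comp_intros]:
  assumes "comp_pred P" "comp_nat A" "comp_nat B"
  shows "comp_nat (\<lambda>p x. if P p x then A p x else B p x)"
proof -
  have "(if P then a else b) = of_bool P * a + (1 - of_bool P) * b" for P and a b :: nat
    by simp
  then show ?thesis
    using assms(1) unfolding comp_pred_def by (simp only:) (intro comp_intros assms)
qed

section \<open>Computable rational numbers\<close>

text \<open>Writing the numerator as a difference of naturals spares case distinctions on signs;
  \<open>Suc\<close> keeps the denominator positive.\<close>

definition comp_rat :: "(baire \<Rightarrow> nat \<Rightarrow> real) \<Rightarrow> bool" where
  "comp_rat R \<longleftrightarrow> (\<exists>U V W. comp_nat U \<and> comp_nat V \<and> comp_nat W \<and>
     (\<forall>p x. R p x = (real (U p x) - real (V p x)) / real (Suc (W p x))))"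

lemma comp_ratI:
  assumes "comp_nat U" "comp_nat V" "comp_nat W"
    "\<And>p x. R p x = (real (U p x) - real (V p x)) / real (Suc (W p x))"
  shows "comp_rat R"
  using assms unfolding comp_rat_def by blast

lemma comp_ratE:
  assumes "comp_rat R"
  obtains U V W where "comp_nat U" "comp_nat V" "comp_nat W"
    "\<And>p x. R p x = (real (U p x) - real (V p x)) / real (Suc (W p x))"
  using assms unfolding comp_rat_def by blast

lemma comp_rat_qdec [comp_intros]:
  assumes "comp_nat A"
  shows "comp_rat (\<lambda>p x. qdec (A p x))"
proof -
  \<comment> \<open>\<open>int_decode\<close> sends 2 m to m and 2 m + 1 to - m - 1.\<close>
  define U where "U a = (if even (nfst a) then nfst a div 2 else 0)" for a
  define V where "V a = (if even (nfst a) then 0 else Suc (nfst a div 2))" for a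
  have "comp_nat (\<lambda>p x. U (A p x))" "comp_nat (\<lambda>p x. V (A p x))" "comp_nat (\<lambda>p x. nsnd (A p x))"
    unfolding U_def V_def by (intro comp_intros assms)+
  moreover have "qdec a = (real (U a) - real (V a)) / real (Suc (nsnd a))" for a
    by (simp add: qdec_def U_def V_def int_decode_def sum_decode_def split: prod.split)
  ultimately show ?thesis
    by (rule comp_ratI)
qed

text \<open>The way back from rational values to natural numbers, through which case distinction,
  recursion and the output of digits are reduced to \<open>comp_nat\<close>.\<close>

lemma comp_rat_code:
  assumes "comp_rat R"
  obtains C where "comp_nat C" "\<And>p x. qdec (C p x) = R p x"
proof -
  obtain U V W where c: "comp_nat U" "comp_nat V" "comp_nat W"
    and R: "\<And>p x. R p x = (real (U p x) - real (V p x)) / real (Suc (W p x))"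
    using assms by (rule comp_ratE) blast
  define C where "C p x = prod_encode (if V p x \<le> U p x then 2 * (U p x - V p x)
    else Suc (2 * (V p x - U p x - 1)), W p x)" for p x
  show thesis
  proof
    show "comp_nat C"
      unfolding C_def by (intro comp_intros c)
    show "qdec (C p x) = R p x" for p x
      by (auto simp: qdec_def C_def R int_decode_def sum_decode_def of_nat_diff)
  qed
qed

lemma comp_rat_of_nat [comp_intros]:
  assumes "comp_nat A" shows "comp_rat (\<lambda>p x. real (A p x))"
  by (rule comp_ratI[of A "\<lambda>p x. 0" "\<lambda>p x. 0"]) (auto intro: comp_intros assms)

lemma comp_rat_const [comp_intros]: "comp_rat (\<lambda>p x. 0)" "comp_rat (\<lambda>p x. 1)" "comp_rat (\<lambda>p x. numeral n)"
  using comp_rat_of_nat[OF comp_nat_const, of 0] comp_rat_of_nat[OF comp_nat_const, of 1]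
    comp_rat_of_nat[OF comp_nat_const, of "numeral n"] by simp_all

lemma comp_rat_add [comp_intros]:
  assumes "comp_rat R" "comp_rat S" shows "comp_rat (\<lambda>p x. R p x + S p x)"
proof -
  obtain U V W where 1: "comp_nat U" "comp_nat V" "comp_nat W"
    "\<And>p x. R p x = (real (U p x) - real (V p x)) / real (Suc (W p x))"
    using assms(1) by (rule comp_ratE) blast
  obtain U' V' W' where 2: "comp_nat U'" "comp_nat V'" "comp_nat W'"
    "\<And>p x. S p x = (real (U' p x) - real (V' p x)) / real (Suc (W' p x))"
    using assms(2) by (rule comp_ratE) blast
  have den: "real (Suc (w * w' + w + w')) = real (Suc w) * real (Suc w')" for w w'
    by (simp add: algebra_simps)
  show ?thesis
    by (rule comp_ratI[of "\<lambda>p x. U p x * Suc (W' p x) + U' p x * Suc (W p x)"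
      "\<lambda>p x. V p x * Suc (W' p x) + V' p x * Suc (W p x)" "\<lambda>p x. W p x * W' p x + W p x + W' p x"])
      ((intro comp_intros 1 2)+, simp only: 1(4) 2(4) den of_nat_add of_nat_mult, simp add: field_simps del: of_nat_Suc)
qed

lemma comp_rat_uminus [comp_intros]:
  assumes "comp_rat R" shows "comp_rat (\<lambda>p x. - R p x)"
proof -
  obtain U V W where 1: "comp_nat U" "comp_nat V" "comp_nat W"
    "\<And>p x. R p x = (real (U p x) - real (V p x)) / real (Suc (W p x))"
    using assms by (rule comp_ratE) blast
  show ?thesis
    by (rule comp_ratI[OF 1(2,1,3)]) (simp add: 1(4) field_simps)
qed

lemma comp_rat_diff [comp_intros]:
  assumes "comp_rat R" "comp_rat S" shows "comp_rat (\<lambda>p x. R p x - S p x)"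
  using comp_rat_add[OF assms(1) comp_rat_uminus[OF assms(2)]] by simp

lemma comp_rat_mult [comp_intros]:
  assumes "comp_rat R" "comp_rat S" shows "comp_rat (\<lambda>p x. R p x * S p x)"
proof -
  obtain U V W where 1: "comp_nat U" "comp_nat V" "comp_nat W"
    "\<And>p x. R p x = (real (U p x) - real (V p x)) / real (Suc (W p x))"
    using assms(1) by (rule comp_ratE) blast
  obtain U' V' W' where 2: "comp_nat U'" "comp_nat V'" "comp_nat W'"
    "\<And>p x. S p x = (real (U' p x) - real (V' p x)) / real (Suc (W' p x))"
    using assms(2) by (rule comp_ratE) blast
  have den: "real (Suc (w * w' + w + w')) = real (Suc w) * real (Suc w')" for w w'
    by (simp add: algebra_simps)
  show ?thesis
    by (rule comp_ratI[of "\<lambda>p x. U p x * U' p x + V p x * V' p x"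
      "\<lambda>p x. U p x * V' p x + V p x * U' p x" "\<lambda>p x. W p x * W' p x + W p x + W' p x"])
      ((intro comp_intros 1 2)+, simp only: 1(4) 2(4) den of_nat_add of_nat_mult, simp add: field_simps del: of_nat_Suc)
qed

lemma comp_rat_divide_nat [comp_intros]:
  assumes "comp_rat R" "comp_nat A" shows "comp_rat (\<lambda>p x. R p x / real (A p x))"
proof -
  \<comment> \<open>The numerator 0 for \<open>A p x = 0\<close> agrees with the convention
    \<open>inverse 0 = 0\<close>.\<close>
  have "comp_rat (\<lambda>p x. inverse (real (A p x)))"
    by (rule comp_ratI[of "\<lambda>p x. if A p x = 0 then 0 else 1" "\<lambda>p x. 0" "\<lambda>p x. A p x - 1"])
      ((intro comp_intros assms)+, auto simp: divide_simps)
  then show ?thesis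
    unfolding divide_inverse by (intro comp_intros assms)
qed

lemma comp_rat_divide_numeral [comp_intros]:
  assumes "comp_rat R" shows "comp_rat (\<lambda>p x. R p x / numeral n)"
  using comp_rat_divide_nat[OF assms comp_nat_const, of "numeral n"] by simp

lemma comp_pred_rat_less [comp_intros]:
  assumes "comp_rat R" "comp_rat S" shows "comp_pred (\<lambda>p x. R p x < S p x)"
proof -
  obtain U V W where 1: "comp_nat U" "comp_nat V" "comp_nat W"
    "\<And>p x. S p x - R p x = (real (U p x) - real (V p x)) / real (Suc (W p x))"
    using comp_rat_diff[OF assms(2,1)] by (rule comp_ratE) blast
  have "R p x < S p x \<longleftrightarrow> V p x < U p x" for p x
    using 1(4)[of p x] by (metis diff_gt_0_iff_gt of_nat_0_less_iff of_nat_less_iff zero_less_Suc zero_less_divide_iff less_asym)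
  then show ?thesis
    by (simp only:) (intro comp_intros 1)
qed

lemma comp_rat_if [comp_intros]:
  assumes "comp_pred P" "comp_rat R" "comp_rat S"
  shows "comp_rat (\<lambda>p x. if P p x then R p x else S p x)"
proof -
  obtain C where C: "comp_nat C" "\<And>p x. qdec (C p x) = R p x"
    using assms(2) by (rule comp_rat_code) blast
  obtain D where D: "comp_nat D" "\<And>p x. qdec (D p x) = S p x"
    using assms(3) by (rule comp_rat_code) blast
  have "comp_rat (\<lambda>p x. qdec (if P p x then C p x else D p x))"
    by (intro comp_intros assms C D)
  then show ?thesis
    by (simp add: if_distrib[of qdec] C D cong: if_cong)
qed

lemma comp_rat_max [comp_intros]:
  assumes "comp_rat R" "comp_rat S" shows "comp_rat (\<lambda>p x. max (R p x) (S p x))"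
proof -
  have "max a b = (if a < b then b else a)" for a b :: real
    by auto
  then show ?thesis
    by (simp only:) (intro comp_intros assms)
qed

lemma comp_rat_abs [comp_intros]:
  assumes "comp_rat R" shows "comp_rat (\<lambda>p x. \<bar>R p x\<bar>)"
  unfolding abs_if by (intro comp_intros assms)

lemma comp_rat_compose:
  assumes "comp_rat R" "comp_nat A"
  shows "comp_rat (\<lambda>p x. R p (A p x))"
proof -
  obtain C where C: "comp_nat C" "\<And>p x. qdec (C p x) = R p x"
    using assms(1) by (rule comp_rat_code) blast
  show ?thesis
    using comp_rat_qdec[OF comp_nat_compose[OF C(1) assms(2)]] by (simp add: C)
qed

lemma comp_rat_compose2:
  assumes "comp_rat (\<lambda>p e. R p (nfst e) (nsnd e))" "comp_nat A" "comp_nat B"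
  shows "comp_rat (\<lambda>p x. R p (A p x) (B p x))"
  using comp_rat_compose[OF assms(1) comp_nat_pair[OF assms(2,3)]] by simp

text \<open>The recursion runs on codes: each step decodes the previous value by \<open>qdec\<close>
  and encodes the new one. Since \<open>G\<close> sees only the decoded value, the choice of code is
  immaterial.\<close>

lemma comp_rat_rec [comp_intros]:
  assumes B: "comp_rat B" and N: "comp_nat N"
    and G: "comp_rat (\<lambda>p e. G p (nfst e) (qdec (nfst (nsnd e))) (nsnd (nsnd e)))"
  shows "comp_rat (\<lambda>p x. rec_nat (B p x) (\<lambda>n y. G p n y x) (N p x))"
proof -
  obtain C where C: "comp_nat C" "\<And>p x. qdec (C p x) = B p x"
    using B by (rule comp_rat_code) blast
  obtain D where D: "comp_nat D"
    "\<And>p e. qdec (D p e) = G p (nfst e) (qdec (nfst (nsnd e))) (nsnd (nsnd e))"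
    using G by (rule comp_rat_code) blast
  have "qdec (rec_nat (C p x) (\<lambda>n y. D p (prod_encode (n, prod_encode (y, x)))) k) =
      rec_nat (B p x) (\<lambda>n y. G p n y x) k" for p x k
    by (induction k) (auto simp: C D)
  moreover have "comp_rat (\<lambda>p x. qdec (rec_nat (C p x) (\<lambda>n y. D p (prod_encode (n, prod_encode (y, x)))) (N p x)))"
    by (intro comp_intros comp_nat_compose[OF D(1)] C N)
  ultimately show ?thesis
    by simp
qed

lemma comp_rat_sum [comp_intros]:
  assumes R: "comp_rat (\<lambda>p e. R p (nfst e) (nsnd e))" and N: "comp_nat N"
  shows "comp_rat (\<lambda>p x. \<Sum>i<N p x. R p i x)"
proof -
  have "(\<Sum>i<n. f i) = rec_nat 0 (\<lambda>i y. y + f i) n" for f :: "nat \<Rightarrow> real" and n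
    by (induction n) auto
  then show ?thesis
    by (simp only:) (intro comp_intros N comp_rat_compose2[OF R])
qed

lemma comp_rat_power [comp_intros]:
  assumes "comp_rat R" "comp_nat A"
  shows "comp_rat (\<lambda>p x. R p x ^ A p x)"
proof -
  have "a ^ n = rec_nat 1 (\<lambda>i y. y * a) n" for a :: real and n
    by (induction n) auto
  then show ?thesis
    by (simp only:) (intro comp_intros assms comp_rat_compose[OF assms(1)])
qed

section \<open>Polynomials with rational coefficients\<close>

lemma prod_decode_0: "prod_decode 0 = (0, 0)"
  using prod_encode_inverse[of "(0, 0)"] by (simp add: prod_encode_def)

text \<open>A nonempty list is coded by the successor of a pair whose second component codes the
  tail. The code 0 of the empty list stays fixed because
  \<open>prod_decode 0 = (0, 0)\<close>.\<close>

lemma list_decode_drop: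
  "list_decode (rec_nat k (\<lambda>_ c. nsnd (c - 1)) i) = drop i (list_decode k)"
proof (induction i)
  case (Suc i)
  have "list_decode (nsnd (c - 1)) = tl (list_decode c)" for c
    by (cases c) (auto simp: prod_decode_0 split: prod.split)
  then show ?case
    using Suc by (simp add: drop_Suc tl_drop)
qed auto

text \<open>Makes the code itself a computable bound for the summation in
  \<open>qpoly\<close>.\<close>

lemma length_list_decode: "length (list_decode k) \<le> k"
proof (induction k rule: list_decode.induct)
  case (2 n)
  obtain x y where xy: "prod_decode n = (x, y)"
    by fastforce
  then have "y \<le> n"
    by (metis le_prod_encode_2 prod_decode_inverse)
  then show ?case
    using 2[OF xy[symmetric]] xy by simp
qed auto

text \<open>Brings the sum into a form covered by the recursion rules. From the end of the list on,
  \<open>c\<close> is 0 and the surplus terms vanish.\<close>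

lemma qpoly_eq:
  "qpoly k x = (\<Sum>i<k. let c = rec_nat k (\<lambda>_ c. nsnd (c - 1)) i
     in if c = 0 then 0 else qdec (nfst (c - 1)) * x ^ i)"
proof -
  have *: "(let c = rec_nat k (\<lambda>_ c. nsnd (c - 1)) i in if c = 0 then 0 else qdec (nfst (c - 1)) * x ^ i)
    = (if i < length (list_decode k) then qdec (list_decode k ! i) * x ^ i else 0)" for i
  proof (cases "rec_nat k (\<lambda>_ c. nsnd (c - 1)) i")
    case 0
    then show ?thesis
      using list_decode_drop[of k i] by simp
  next
    case (Suc m)
    then have "nfst m # list_decode (nsnd m) = drop i (list_decode k)"
      using list_decode_drop[of k i] by (simp split: prod.splits)
    then have "i < length (list_decode k)" "list_decode k ! i = nfst m"
      by (metis drop_all list.distinct(1) not_le, metis nth_via_drop)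
    then show ?thesis
      using Suc by (simp add: Let_def)
  qed
  show ?thesis
    unfolding * unfolding qpoly_def Let_def
    by (rule sum.mono_neutral_cong_left) (use length_list_decode[of k] in auto)
qed

lemma comp_rat_qpoly [comp_intros]:
  assumes "comp_nat A" "comp_rat R"
  shows "comp_rat (\<lambda>p x. qpoly (A p x) (R p x))"
  unfolding qpoly_eq Let_def
  by (intro comp_intros comp_nat_compose[OF assms(1)] comp_rat_compose[OF assms(2)] assms)

lemma comp_nat_list_encode [comp_intros]:
  assumes F: "comp_nat (\<lambda>p e. F p (nfst e) (nsnd e))" and N: "comp_nat N"
  shows "comp_nat (\<lambda>p x. list_encode (map (\<lambda>i. F p i x) [0..<N p x]))"
proof -
  \<comment> \<open>List codes grow at the front, so the recursion proceeds from the last element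
    backwards and has coded the final \<open>m\<close> entries after \<open>m\<close> steps.\<close>
  have "m \<le> n \<Longrightarrow> list_encode (map f [n - m..<n]) = rec_nat 0 (\<lambda>i y. Suc (prod_encode (f (n - Suc i), y))) m"
    for f n m
  proof (induction m)
    case (Suc m)
    then have "[n - Suc m..<n] = (n - Suc m) # [n - m..<n]"
      by (simp add: upt_conv_Cons Suc_diff_Suc)
    then show ?case
      using Suc by simp
  qed auto
  from this[of n n for n] have "list_encode (map f [0..<n]) = rec_nat 0 (\<lambda>i y. Suc (prod_encode (f (n - Suc i), y))) n" for f n
    by simp
  then show ?thesis
    by (simp only:) (intro comp_intros N comp_nat_compose2[OF F] comp_nat_compose[OF N])
qed

lemma computable_total:
  assumes "comp_nat (\<lambda>p x. F p x)"
  shows "computable (\<lambda>p. Some (F p))"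
proof -
  obtain e where "\<And>p xs. length xs = 1 \<Longrightarrow> ev p e xs (F p (xs ! 0))"
    using assms by (auto simp: comp_nat_def rec_fun_def)
  from this[of "[_]"] show ?thesis
    unfolding computable_def by auto
qed

section \<open>From the intermediate value theorem to closed choice\<close>

text \<open>The values 0 and 1 start the bisection; -1 and 2 are outer endpoints beyond the unit
  interval.\<close>

lemma qdec_eqs: "qdec 0 = 0" "qdec (prod_encode (2, 0)) = 1" "qdec (prod_encode (Suc 0, 0)) = -1"
  "qdec (prod_encode (4, 0)) = 2"
  by (simp_all add: qdec_def int_decode_def sum_decode_def prod_decode_0)

lemma qdec_surj:
  assumes "x \<in> \<rat>"
  obtains j where "qdec j = x"
proof -
  obtain a b where ab: "b > 0" "x = real_of_int a / real_of_int b"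
    using assms by (metis Rats_cases' )
  have "qdec (prod_encode (int_encode a, nat b - 1)) = x"
    using ab by (simp add: qdec_def)
  then show ?thesis
    by (rule that)
qed

text \<open>Stage n = \<langle>j, k\<rangle> tests the j-th rational at precision 2^-k. Comparing signs with an
  approximation of f(0) instead of a fixed sign covers both cases f(0) < 0 and f(0) > 0.\<close>

definition bisect_state :: "baire \<Rightarrow> nat \<Rightarrow> nat" where
  "bisect_state p = rec_nat (prod_encode (0, prod_encode (2, 0))) (\<lambda>n s.
     if qdec (nfst s) < qdec (nfst n) \<and> qdec (nfst n) < qdec (nsnd s)
       \<and> (1/2) ^ nsnd n < \<bar>qpoly (p (nsnd n)) 0\<bar>
       \<and> (1/2) ^ nsnd n < \<bar>qpoly (p (nsnd n)) (qdec (nfst n))\<bar>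
     then if 0 < qpoly (p (nsnd n)) 0 * qpoly (p (nsnd n)) (qdec (nfst n))
       then prod_encode (nfst n, nsnd s) else prod_encode (nfst s, nfst n)
     else s)"

text \<open>Even digits enumerate the intervals (-1, a) and odd digits the intervals (b, 2), so that
  0 and 1 can be covered although the intervals are open. The \<open>Suc\<close> is there because
  the digit 0 means no interval.\<close>

definition zero_interval :: "baire \<Rightarrow> baire" where
  "zero_interval p n = Suc (prod_encode (
     if even n then (prod_encode (Suc 0, 0), nfst (bisect_state p (n div 2)))
     else (nsnd (bisect_state p (n div 2)), prod_encode (4, 0))))"

lemma computable_zero_interval: "computable (\<lambda>p. Some (zero_interval p))"
proof (rule computable_total)
  have bisect: "comp_nat (\<lambda>p n. bisect_state p n)"
    unfolding bisect_state_def by (intro comp_intros)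
  show "comp_nat (\<lambda>p x. zero_interval p x)"
    unfolding zero_interval_def if_distrib[of prod_encode]
    by (intro comp_intros comp_nat_compose[OF bisect])
qed

lemma sgn_approx:
  fixes u v e :: real
  assumes "\<bar>v - u\<bar> \<le> e" "e < \<bar>v\<bar>"
  shows "sgn v = sgn u"
  using assms by (auto simp: sgn_if)

lemma half_power_less:
  fixes e :: real
  assumes "e > 0"
  obtains k where "(1/2) ^ k < e"
  using real_arch_pow_inv[of e "1/2"] assms by auto

text \<open>If the limits \<alpha> < \<beta> differ, \<open>f\<close> vanishes at every rational
  between them, since otherwise an endpoint would have moved there; continuity does the rest. If
  they coincide, the opposite signs at the endpoints force a zero in the limit.\<close>

lemma zero_interval_correct:
  assumes p: "cfun_rep p f" and f: "f 0 * f 1 < 0"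
  obtains A where "closed_rep (zero_interval p) A" "A \<in> CI_dom" "\<And>x. x \<in> A \<Longrightarrow> 0 \<le> x \<and> x \<le> 1 \<and> f x = 0"
proof -
  define a where "a n = qdec (nfst (bisect_state p n))" for n
  define b where "b n = qdec (nsnd (bisect_state p n))" for n
  define fires where "fires n \<longleftrightarrow> a n < qdec (nfst n) \<and> qdec (nfst n) < b n
       \<and> (1/2) ^ nsnd n < \<bar>qpoly (p (nsnd n)) 0\<bar>
       \<and> (1/2) ^ nsnd n < \<bar>qpoly (p (nsnd n)) (qdec (nfst n))\<bar>" for n
  define pos where "pos n \<longleftrightarrow> 0 < qpoly (p (nsnd n)) 0 * qpoly (p (nsnd n)) (qdec (nfst n))" for n
  have rec: "a 0 = 0" "b 0 = 1"
    "a (Suc n) = (if fires n \<and> pos n then qdec (nfst n) else a n)"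
    "b (Suc n) = (if fires n \<and> \<not> pos n then qdec (nfst n) else b n)" for n
    by (auto simp: a_def b_def fires_def pos_def bisect_state_def qdec_eqs)
  have cont: "continuous_on {0..1} f"
    and approx: "\<And>n x. x \<in> {0..1} \<Longrightarrow> \<bar>qpoly (p n) x - f x\<bar> \<le> (1/2) ^ n"
    using p by (auto simp: cfun_rep_def)
  \<comment> \<open>The left endpoint keeps the sign of \<open>f 0\<close>, the right one the
    opposite sign.\<close>
  have inv: "0 \<le> a n \<and> a n < b n \<and> b n \<le> 1 \<and> 0 < f 0 * f (a n) \<and> f 0 * f (b n) < 0" for n
  proof (induction n)
    case 0
    then show ?case
      using f by (auto simp: rec zero_less_mult_iff mult_less_0_iff)
  next
    case (Suc n)
    show ?case
    proof (cases "fires n")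
      case True
      define x where "x = qdec (nfst n)"
      have x: "a n < x" "x < b n"
        using True by (auto simp: fires_def x_def)
      \<comment> \<open>Both approximations exceed their error bound in absolute value, so their
        signs are the true ones and \<open>pos n\<close> decides correctly.\<close>
      then have "sgn (qpoly (p (nsnd n)) 0) = sgn (f 0)" "sgn (qpoly (p (nsnd n)) x) = sgn (f x)"
        using True Suc by (auto simp: fires_def x_def[symmetric] intro!: sgn_approx[OF approx])
      moreover have "qpoly (p (nsnd n)) 0 \<noteq> 0" "qpoly (p (nsnd n)) x \<noteq> 0"
        using True zero_less_power[of "1/2::real" "nsnd n"] unfolding fires_def x_def[symmetric] by linarith+
      ultimately have "0 < f 0 * f x \<longleftrightarrow> pos n" "f 0 * f x < 0 \<longleftrightarrow> \<not> pos n"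
        unfolding pos_def x_def[symmetric] by (auto simp: sgn_if zero_less_mult_iff mult_less_0_iff split: if_splits)
      then show ?thesis
        using True x Suc by (auto simp: rec x_def[symmetric])
    qed (use Suc in \<open>simp add: rec\<close>)
  qed
  have "a n \<le> a (Suc n)" "b (Suc n) \<le> b n" for n
    by (auto simp: rec fires_def)
  then have mono: "incseq a" "decseq b"
    by (auto intro: incseq_SucI decseq_SucI)
  have ab: "a m \<le> b n" for m n
    using incseqD[OF mono(1), of m "max m n"] decseqD[OF mono(2), of n "max m n"] inv[of "max m n"] by simp
  have bdd: "bdd_above (range a)" "bdd_below (range b)"
    using ab by (auto intro!: bdd_aboveI2 bdd_belowI2)
  define \<alpha> where "\<alpha> = (SUP n. a n)"
  define \<beta> where "\<beta> = (INF n. b n)"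
  have alpha: "a n \<le> \<alpha>" and beta: "\<beta> \<le> b n" for n
    unfolding \<alpha>_def \<beta>_def using bdd by (auto intro: cSUP_upper cINF_lower)
  have ord: "\<alpha> \<le> \<beta>"
    unfolding \<alpha>_def \<beta>_def by (intro cSUP_least cINF_greatest ab) auto
  have unit: "0 \<le> \<alpha>" "\<beta> \<le> 1"
    using alpha[of 0] beta[of 0] by (auto simp: rec)
  have f0: "f 0 \<noteq> 0"
    using f by auto
  have rational: "f x = 0" if x: "x \<in> \<rat>" "\<alpha> < x" "x < \<beta>" for x
  proof (rule ccontr)
    assume fx: "f x \<noteq> 0"
    \<comment> \<open>With an error below half of each value, the approximations stay above that
      half and hence above the error.\<close>
    have "0 < min \<bar>f 0\<bar> \<bar>f x\<bar> / 2"
      using fx f0 by auto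
    then obtain k where k: "(1/2) ^ k < min \<bar>f 0\<bar> \<bar>f x\<bar> / 2"
      by (rule half_power_less)
    obtain j where j: "qdec j = x"
      by (rule qdec_surj[OF x(1)])
    have "\<bar>qpoly (p k) 0 - f 0\<bar> \<le> (1/2) ^ k" "\<bar>qpoly (p k) x - f x\<bar> \<le> (1/2) ^ k"
      using that unit by (auto intro!: approx)
    \<comment> \<open>The stage coded by \<open>j\<close> and \<open>k\<close> makes
      \<open>x\<close> an endpoint, although \<open>x\<close> lies strictly between all
      endpoints.\<close>
    then have "fires (prod_encode (j, k))"
      using k j that alpha[of "prod_encode (j, k)"] beta[of "prod_encode (j, k)"] unfolding fires_def by auto
    then have "a (Suc (prod_encode (j, k))) = x \<or> b (Suc (prod_encode (j, k))) = x"
      using j by (auto simp: rec)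
    then show False
      using alpha[of "Suc (prod_encode (j, k))"] beta[of "Suc (prod_encode (j, k))"] that by auto
  qed
  have zero: "f y = 0" if y: "y \<in> {\<alpha>..\<beta>}" for y
  proof (cases "\<alpha> < \<beta>")
    case True
    show ?thesis
    proof (rule ccontr)
      assume "f y \<noteq> 0"
      moreover have "y \<in> {0..1}"
        using y unit by auto
      ultimately obtain d where d: "d > 0" "\<And>x. x \<in> {0..1} \<Longrightarrow> \<bar>x - y\<bar> < d \<Longrightarrow> f x \<noteq> 0"
        using continuous_on_avoid[OF cont, of y 0] by (auto simp: dist_real_def abs_minus_commute)
      \<comment> \<open>Since \<open>y\<close> may be an endpoint, the rational is sought where the
        zero-free neighbourhood of \<open>y\<close> meets the open interval.\<close>
      have "max \<alpha> (y - d) < min \<beta> (y + d)"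
        using True d y by auto
      then obtain x where "x \<in> \<rat>" "max \<alpha> (y - d) < x" "x < min \<beta> (y + d)"
        using Rats_dense_in_real by blast
      then show False
        using rational[of x] d(2)[of x] unit by (auto simp: abs_less_iff)
    qed
  next
    case False
    then have y': "y = \<alpha>" "y = \<beta>"
      using y by auto
    \<comment> \<open>The product \<open>f 0 * f x\<close> is positive along \<open>a\<close> and
      negative along \<open>b\<close>, hence 0 at the common limit.\<close>
    have "a \<longlonglongrightarrow> y" "b \<longlonglongrightarrow> y"
      using LIMSEQ_incseq_SUP[OF bdd(1) mono(1)] LIMSEQ_decseq_INF[OF bdd(2) mono(2)]
      by (simp_all add: y' \<alpha>_def[symmetric] \<beta>_def[symmetric]) (simp add: y'[symmetric])+
    moreover have "y \<in> {0..1}"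
      using y unit by auto
    moreover have "a n \<in> {0..1}" "b n \<in> {0..1}" for n
      using inv[of n] by auto
    ultimately have "(\<lambda>n. f 0 * f (a n)) \<longlonglongrightarrow> f 0 * f y" "(\<lambda>n. f 0 * f (b n)) \<longlonglongrightarrow> f 0 * f y"
      by (auto intro!: tendsto_mult continuous_on_tendsto_compose[OF cont])
    then have "0 \<le> f 0 * f y" "f 0 * f y \<le> 0"
      using inv by (auto intro: LIMSEQ_le_const LIMSEQ_le_const2 less_imp_le)
    then show ?thesis
      using f0 by (auto simp: zero_le_mult_iff mult_le_0_iff)
  qed
  have "x < \<alpha> \<longleftrightarrow> (\<exists>n. x < a n)" "\<beta> < x \<longleftrightarrow> (\<exists>n. b n < x)" for x
    unfolding \<alpha>_def \<beta>_def using bdd by (simp_all add: less_cSUP_iff cINF_less_iff)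
  then have "{0..1} - {\<alpha>..\<beta>} = (\<Union>n. {x \<in> {0..1}. x < a n}) \<union> (\<Union>n. {x \<in> {0..1}. b n < x})"
    by (simp add: set_eq_iff not_le) blast
  moreover have nonzero: "zero_interval p n \<noteq> 0" for n
    by (simp add: zero_interval_def)
  moreover have "\<Union>(range X) = (\<Union>n. X (2 * n)) \<union> (\<Union>n. X (Suc (2 * n)))" for X :: "nat \<Rightarrow> real set"
  proof -
    have "\<exists>k. n = 2 * k \<or> n = Suc (2 * k)" for n :: nat
      by presburger
    then show ?thesis
      by (simp add: set_eq_iff) metis
  qed
  from this[of "\<lambda>n. qint (zero_interval p n - 1)"] have "(\<Union>n\<in>{n. zero_interval p n \<noteq> 0}. qint (zero_interval p n - 1)) =
      (\<Union>n. qint (zero_interval p (2 * n) - 1)) \<union> (\<Union>n. qint (zero_interval p (Suc (2 * n)) - 1))"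
    by (simp add: nonzero)
  moreover have "qint (zero_interval p (2 * n) - 1) = {x \<in> {0..1}. x < a n}"
    "qint (zero_interval p (Suc (2 * n)) - 1) = {x \<in> {0..1}. b n < x}" for n
    by (auto simp: zero_interval_def qint_def qdec_eqs a_def b_def)
  ultimately have "closed_rep (zero_interval p) {\<alpha>..\<beta>}"
    using unit by (auto simp: closed_rep_def)
  moreover have "{\<alpha>..\<beta>} \<in> CI_dom"
    using unit ord by (auto simp: CI_dom_def)
  moreover have "0 \<le> x \<and> x \<le> 1 \<and> f x = 0" if "x \<in> {\<alpha>..\<beta>}" for x
    using zero[OF that] that unit by simp
  ultimately show thesis
    by (rule that)
qed

text \<open>Every point of the computed interval is already a zero, so the outer map H is the
  identity.\<close>

lemma IVT_le_CI: "sW_le cfun_rep unit_rep IVT_dom IVT_map closed_rep unit_rep CI_dom CI_map"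
proof -
  have "computable (\<lambda>p. Some p)"
    by (intro computable_total comp_intros)
  moreover have "realizer cfun_rep unit_rep IVT_dom IVT_map
      (\<lambda>p. Option.bind (Option.bind (Some (zero_interval p)) G) Some)"
    if G: "realizer closed_rep unit_rep CI_dom CI_map G" for G
    unfolding realizer_def
  proof (intro allI impI)
    fix p f
    assume p: "cfun_rep p f" and f: "f \<in> IVT_dom"
    have "f 0 * f 1 < 0"
      using f by (simp add: IVT_dom_def)
    with p obtain A where A: "closed_rep (zero_interval p) A" "A \<in> CI_dom"
      "\<And>x. x \<in> A \<Longrightarrow> 0 \<le> x \<and> x \<le> 1 \<and> f x = 0"
      by (rule zero_interval_correct) blast
    obtain q y where "G (zero_interval p) = Some q" "unit_rep q y" "y \<in> A"
      using G A(1,2) unfolding realizer_def CI_map_def by blast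
    then show "\<exists>q y. Option.bind (Option.bind (Some (zero_interval p)) G) Some = Some q \<and>
        unit_rep q y \<and> y \<in> IVT_map f"
      using A(3) by (auto simp: IVT_map_def)
  qed
  ultimately show ?thesis
    using computable_zero_interval unfolding sW_le_def by blast
qed

section \<open>Bernstein approximation of Lipschitz functions\<close>

text \<open>This is the variance of a binomial variable divided by \<open>N\<close>. The square is
  expanded into second factorial moment, mean and total mass.\<close>

lemma sum_sq_Bernstein:
  assumes "N > 0"
  shows "(\<Sum>k\<le>N. (x - real k / real N)\<^sup>2 * Bernstein N k x) = x * (1 - x) / real N"
proof -
  have *: "(x - real k / real N)\<^sup>2 * Bernstein N k x = (real k * (real k - 1) * Bernstein N k x
      + (1 - 2 * real N * x) * (real k * Bernstein N k x) + (real N * x)\<^sup>2 * Bernstein N k x) / (real N)\<^sup>2" for k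
    using assms by (simp add: field_simps power2_eq_square)
  show ?thesis
    unfolding * sum_divide_distrib[symmetric] sum.distrib sum_distrib_left[symmetric] sum_kk_Bernstein
      sum_k_Bernstein sum_Bernstein
    using assms by (simp add: field_simps power2_eq_square)
qed

text \<open>The rate is explicit so that a sufficient degree can be computed from the precision. The
  mean deviation is bounded through the variance, and the weight s = sqrt N balances the two parts
  at L / (4 s) each.\<close>

lemma Bernstein_Lipschitz:
  fixes F :: "real \<Rightarrow> real"
  assumes N: "N > 0" and F: "\<And>x y. x \<in> {0..1} \<Longrightarrow> y \<in> {0..1} \<Longrightarrow> \<bar>F x - F y\<bar> \<le> L * \<bar>x - y\<bar>"
    and x: "x \<in> {0..1}"
  shows "\<bar>(\<Sum>k\<le>N. F (real k / real N) * Bernstein N k x) - F x\<bar> \<le> L / (2 * sqrt (real N))"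
proof -
  have L: "0 \<le> L"
    using F[of 0 1] by simp
  define s where "s = sqrt (real N)"
  have s: "s > 0" "real N = s\<^sup>2"
    using N by (auto simp: s_def)
  have B: "0 \<le> Bernstein N k x" for k
    using x by (intro Bernstein_nonneg) auto
  have bound: "\<bar>F (real k / real N) - F x\<bar> \<le> L * (1 / (4 * s) + s * (x - real k / real N)\<^sup>2)" if "k \<le> N" for k
  proof -
    \<comment> \<open>Divided by 4 s, this reads t \<le> 1 / (4 s) + s t^2 for t = |x - k /
      N|.\<close>
    have "0 \<le> (2 * s * \<bar>x - real k / real N\<bar> - 1)\<^sup>2"
      by simp
    then have "\<bar>x - real k / real N\<bar> \<le> 1 / (4 * s) + s * (x - real k / real N)\<^sup>2"
      using s(1) by (simp add: power2_diff power_mult_distrib field_simps power2_eq_square)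
    then have "L * \<bar>real k / real N - x\<bar> \<le> L * (1 / (4 * s) + s * (x - real k / real N)\<^sup>2)"
      using L by (intro mult_left_mono) (auto simp: abs_minus_commute)
    then show ?thesis
      using F[of "real k / real N" x] x that N by (auto simp: divide_le_eq_1)
  qed
  have "(\<Sum>k\<le>N. F (real k / real N) * Bernstein N k x) - F x
      = (\<Sum>k\<le>N. (F (real k / real N) - F x) * Bernstein N k x)"
    by (simp add: left_diff_distrib sum_subtractf sum_distrib_left[symmetric])
  also have "\<bar>\<dots>\<bar> \<le> (\<Sum>k\<le>N. L * (1 / (4 * s) + s * (x - real k / real N)\<^sup>2) * Bernstein N k x)"
    using B by (intro order_trans[OF sum_abs] sum_mono) (auto simp: abs_mult intro!: mult_right_mono bound)
  also have "\<dots> = L / (4 * s) * (\<Sum>k\<le>N. Bernstein N k x)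
      + L * s * (\<Sum>k\<le>N. (x - real k / real N)\<^sup>2 * Bernstein N k x)"
    by (simp only: sum_distrib_left sum.distrib[symmetric]) (intro sum.cong, auto simp: algebra_simps)
  also have "\<dots> = L / (4 * s) + L * (x * (1 - x)) / s"
    unfolding sum_sq_Bernstein[OF N] sum_Bernstein using s by (simp add: power2_eq_square)
  also have "\<dots> \<le> L / (4 * s) + L * (1 / 4) / s"
  proof -
    have "0 \<le> (2 * x - 1)\<^sup>2"
      by simp
    then have "x * (1 - x) \<le> 1 / 4"
      by (simp add: power2_eq_square algebra_simps)
    then show ?thesis
      using L s by (intro add_left_mono divide_right_mono mult_left_mono) auto
  qed
  also have "\<dots> = L / (2 * sqrt (real N))"
    using s by (simp add: s_def[symmetric])
  finally show ?thesis .
qed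

text \<open>Names of continuous functions list monomial coefficients. Expanding (1 - x)^(N - k) and
  collecting powers merges two binomial coefficients into one quotient of factorials, which the
  computability rules cover.\<close>

lemma Bernstein_sum_coefficients:
  "(\<Sum>k\<le>N. v k * Bernstein N k x) = (\<Sum>i<Suc N. (\<Sum>k<Suc i.
     v k * (-1) ^ (i - k) * real (fact N) / real (fact k * fact (i - k) * fact (N - i))) * x ^ i)"
proof -
  define g where "g k j = v k * real (N choose k) * real ((N - k) choose j) * (-1) ^ j * x ^ (k + j)" for k j
  have "v k * Bernstein N k x = (\<Sum>j\<le>N - k. g k j)" for k
  proof -
    have "(1 - x) ^ (N - k) = (\<Sum>j\<le>N - k. real ((N - k) choose j) * (-1) ^ j * x ^ j)"
      using binomial_ring[of "-x" 1 "N - k"] by (simp add: power_minus[of x] mult.assoc)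
    then show ?thesis
      by (simp add: Bernstein_def g_def sum_distrib_left power_add mult_ac)
  qed
  then have "(\<Sum>k\<le>N. v k * Bernstein N k x) = (\<Sum>k\<le>N. \<Sum>j\<le>N - k. g k j)"
    by simp
  also have "\<dots> = (\<Sum>(k, j)\<in>{(k, j). k + j \<le> N}. g k j)"
    by (subst sum.Sigma) (auto intro!: sum.cong)
  also have "\<dots> = (\<Sum>i\<le>N. \<Sum>k\<le>i. g k (i - k))"
    by (rule sum.triangle_reindex_eq)
  also have "\<dots> = (\<Sum>i\<le>N. (\<Sum>k\<le>i. v k * (-1) ^ (i - k) * real (fact N)
      / real (fact k * fact (i - k) * fact (N - i))) * x ^ i)"
    unfolding sum_distrib_right
  proof (intro sum.cong refl)
    fix i k
    assume "i \<in> {..N}" "k \<in> {..i}"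
    then have "k \<le> i" "i \<le> N"
      by auto
    then show "g k (i - k) = v k * (-1) ^ (i - k) * real (fact N)
        / real (fact k * fact (i - k) * fact (N - i)) * x ^ i"
      by (simp add: g_def binomial_fact mult_ac)
  qed
  finally show ?thesis
    by (simp only: lessThan_Suc_atMost)
qed

section \<open>From closed choice to the intermediate value theorem\<close>

text \<open>Stage n tries the nfst n-th enumerated interval, so every interval is tried
  infinitely often.\<close>

definition left_cover :: "baire \<Rightarrow> nat \<Rightarrow> nat" where
  "left_cover p = rec_nat 0 (\<lambda>n l. if 0 < p (nfst n) \<and> qdec (nfst (p (nfst n) - 1)) < qdec l
     \<and> qdec l < qdec (nsnd (p (nfst n) - 1)) then nsnd (p (nfst n) - 1) else l)"

definition right_cover :: "baire \<Rightarrow> nat \<Rightarrow> nat" where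
  "right_cover p = rec_nat (prod_encode (2, 0)) (\<lambda>n r. if 0 < p (nfst n) \<and> qdec (nfst (p (nfst n) - 1)) < qdec r
     \<and> qdec r < qdec (nsnd (p (nfst n) - 1)) then nfst (p (nfst n) - 1) else r)"

text \<open>An interval that jumps over \<open>a\<close> would contain \<open>a\<close>, so
  \<open>l\<close> stays below. A supremum below \<open>a\<close> would lie in some enumerated
  interval, and a later trial of that interval would push \<open>l\<close> past it. Real endpoints
  instead of codes allow reuse under reflection.\<close>

lemma greedy_cover:
  fixes u v l :: "nat \<Rightarrow> real"
  assumes ab: "0 \<le> a" "a \<le> b" "b \<le> 1"
    and U: "{0..1} - {a..b} = (\<Union>j\<in>D. {x \<in> {0..1}. u j < x \<and> x < v j})"
    and l: "l 0 = 0" "\<And>n. l (Suc n) =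
      (if nfst n \<in> D \<and> u (nfst n) < l n \<and> l n < v (nfst n) then v (nfst n) else l n)"
  shows "0 \<le> l n" "l n \<le> a" "y < a \<Longrightarrow> \<exists>n. y < l n"
proof -
  have mono: "incseq l"
    by (rule incseq_SucI) (simp add: l)
  show nonneg: "0 \<le> l n" for n
    using incseqD[OF mono, of 0 n] by (simp add: l)
  have le: "l n \<le> a" for n
  proof (induction n)
    case (Suc n)
    show ?case
    proof (rule ccontr)
      assume gt: "\<not> l (Suc n) \<le> a"
      then have "nfst n \<in> D" "u (nfst n) < l n" "a < v (nfst n)"
        using Suc by (auto simp: l split: if_splits)
      moreover have "a \<in> {0..1}"
        using ab by auto
      ultimately have "a \<in> {0..1} - {a..b}"
        using Suc unfolding U by force
      then show False
        using ab by auto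
    qed
  qed (simp add: l ab)
  show "l n \<le> a"
    by (rule le)
  show "\<exists>n. y < l n" if "y < a"
  proof (rule ccontr)
    assume "\<not> (\<exists>n. y < l n)"
    then have y: "l n \<le> y" for n
      by (auto simp: not_less)
    have bdd: "bdd_above (range l)"
      using le by (auto intro!: bdd_aboveI2)
    define L where "L = (SUP n. l n)"
    have L: "l n \<le> L" for n
      unfolding L_def using bdd by (auto intro: cSUP_upper)
    have "L \<le> y"
      unfolding L_def using y by (auto intro: cSUP_least)
    then have "L \<in> {0..1} - {a..b}"
      using L[of 0] that ab by (auto simp: l)
    then obtain j where j: "j \<in> D" "u j < L" "L < v j"
      unfolding U by auto
    then obtain m where m: "u j < l m"
      using bdd by (auto simp: L_def less_cSUP_iff)
    \<comment> \<open>This stage tries interval \<open>j\<close> and comes no earlier than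
      \<open>m\<close>, so \<open>l n\<close> already exceeds \<open>u j\<close>.\<close>
    define n where "n = prod_encode (j, m)"
    have "u j < l n" "l n < v j"
      using m incseqD[OF mono le_prod_encode_2[of m j]] L[of n] j by (auto simp: n_def)
    then have "l (Suc n) = v j"
      using j by (auto simp: l n_def)
    then show False
      using L[of "Suc n"] j by auto
  qed
qed

lemma cover_correct:
  assumes p: "closed_rep p {a..b}" and ab: "0 \<le> a" "a \<le> b" "b \<le> 1"
  shows "0 \<le> qdec (left_cover p n)" "qdec (left_cover p n) \<le> a" "b \<le> qdec (right_cover p n)"
    "qdec (right_cover p n) \<le> 1" "y < a \<Longrightarrow> \<exists>n. y < qdec (left_cover p n)"
    "b < y \<Longrightarrow> \<exists>n. qdec (right_cover p n) < y"
proof -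
  define D where "D = {n. p n \<noteq> 0}"
  define u where "u n = qdec (nfst (p n - 1))" for n
  define v where "v n = qdec (nsnd (p n - 1))" for n
  have U: "{0..1} - {a..b} = (\<Union>j\<in>D. {x \<in> {0..1}. u j < x \<and> x < v j})"
    using p by (simp add: closed_rep_def D_def u_def v_def qint_def case_prod_unfold)
  note left = greedy_cover[OF ab U, of "\<lambda>n. qdec (left_cover p n)"]
  show "0 \<le> qdec (left_cover p n)" "qdec (left_cover p n) \<le> a" "y < a \<Longrightarrow> \<exists>n. y < qdec (left_cover p n)"
    by (rule left; simp add: left_cover_def qdec_eqs D_def u_def v_def)+
  \<comment> \<open>The reflection x -> 1 - x turns the right cover into a left cover of the
    mirrored interval.\<close>
  have U': "{0..1} - {1 - b..1 - a} = (\<Union>j\<in>D. {x \<in> {0..1}. 1 - v j < x \<and> x < 1 - u j})"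
  proof (rule set_eqI)
    fix x
    have "x \<in> {0..1} - {1 - b..1 - a} \<longleftrightarrow> 1 - x \<in> {0..1} - {a..b}"
      by auto
    also have "\<dots> \<longleftrightarrow> x \<in> (\<Union>j\<in>D. {x \<in> {0..1}. 1 - v j < x \<and> x < 1 - u j})"
      unfolding U by (auto simp: algebra_simps)
    finally show "x \<in> {0..1} - {1 - b..1 - a} \<longleftrightarrow> x \<in> (\<Union>j\<in>D. {x \<in> {0..1}. 1 - v j < x \<and> x < 1 - u j})" .
  qed
  have ab': "0 \<le> 1 - b" "1 - b \<le> 1 - a" "1 - a \<le> 1"
    using ab by auto
  note right = greedy_cover[OF ab' U', of "\<lambda>n. 1 - qdec (right_cover p n)"]
  have "0 \<le> 1 - qdec (right_cover p n)" "1 - qdec (right_cover p n) \<le> 1 - b"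
    "1 - y < 1 - b \<Longrightarrow> \<exists>n. 1 - y < 1 - qdec (right_cover p n)"
    by (rule right; auto simp add: right_cover_def qdec_eqs D_def u_def v_def)+
  then show "b \<le> qdec (right_cover p n)" "qdec (right_cover p n) \<le> 1" "b < y \<Longrightarrow> \<exists>n. qdec (right_cover p n) < y"
    by auto
qed

text \<open>The substitution y = 3 x - 1 places [0,1] inside [-1,2], so that the sign change at the
  endpoints is strict even if the closed interval contains 0 or 1.\<close>

definition ramp :: "baire \<Rightarrow> nat \<Rightarrow> real \<Rightarrow> real" where
  "ramp p m x = (1/2) ^ m *
     (max 0 (3 * x - 1 - qdec (right_cover p m)) - max 0 (qdec (left_cover p m) - (3 * x - 1)))"

text \<open>The restriction meets the extensionality demanded by \<open>cfun_rep\<close>.\<close>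

definition ramp_sum :: "baire \<Rightarrow> real \<Rightarrow> real" where
  "ramp_sum p = restrict (\<lambda>x. \<Sum>m. ramp p m x) {0..1}"

text \<open>Each of the two maxima contributes slope at most 3.\<close>

lemma ramp_Lipschitz: "\<bar>ramp p m x - ramp p m y\<bar> \<le> 6 * (1/2) ^ m * \<bar>x - y\<bar>"
proof -
  let ?h = "\<lambda>x. max 0 (3 * x - 1 - qdec (right_cover p m)) - max 0 (qdec (left_cover p m) - (3 * x - 1))"
  have "\<bar>?h x - ?h y\<bar> \<le> 6 * \<bar>x - y\<bar>"
    by (auto simp: max_def abs_if)
  then have "(1/2) ^ m * \<bar>?h x - ?h y\<bar> \<le> (1/2) ^ m * (6 * \<bar>x - y\<bar>)"
    by (intro mult_left_mono) auto
  moreover have "ramp p m x - ramp p m y = (1/2) ^ m * (?h x - ?h y)"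
    by (simp add: ramp_def right_diff_distrib)
  ultimately show ?thesis
    by (simp add: abs_mult mult_ac)
qed

text \<open>The weights sum to less than 2, so one constant serves the Bernstein estimate for every
  number of summands.\<close>

lemma ramp_partial_Lipschitz: "\<bar>(\<Sum>m<M. ramp p m x) - (\<Sum>m<M. ramp p m y)\<bar> \<le> 12 * \<bar>x - y\<bar>"
proof -
  have "\<bar>(\<Sum>m<M. ramp p m x) - (\<Sum>m<M. ramp p m y)\<bar> \<le> (\<Sum>m<M. 6 * \<bar>x - y\<bar> * (1/2) ^ m)"
    unfolding sum_subtractf[symmetric]
    by (intro order_trans[OF sum_abs] sum_mono) (use ramp_Lipschitz in \<open>simp add: mult_ac\<close>)
  also have "\<dots> = 6 * \<bar>x - y\<bar> * (2 - 2 * (1/2) ^ M)"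
    unfolding sum_distrib_left[symmetric] by (simp add: sum_gp_strict)
  also have "\<dots> \<le> 6 * \<bar>x - y\<bar> * 2"
    by (intro mult_left_mono) auto
  finally show ?thesis
    by simp
qed

text \<open>A geometric bound on the ramps yields the tail estimate and uniform convergence. Outside
  [a, b] all ramps have the same weak sign, and one of them is nonzero because the covers converge
  to \<open>a\<close> and \<open>b\<close>.\<close>

lemma ramp_sum_correct:
  assumes p: "closed_rep p {a..b}" and ab: "0 \<le> a" "a \<le> b" "b \<le> 1"
  shows "x \<in> {0..1} \<Longrightarrow> \<bar>(\<Sum>m<M. ramp p m x) - ramp_sum p x\<bar> \<le> 4 * (1/2) ^ M"
    and "continuous_on {0..1} (ramp_sum p)"
    and "ramp_sum p 0 < 0" and "0 < ramp_sum p 1"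
    and "x \<in> {0..1} \<Longrightarrow> ramp_sum p x = 0 \<Longrightarrow> 3 * x - 1 \<in> {a..b}"
proof -
  note cov = cover_correct[OF p ab]
  have bound: "\<bar>ramp p m x\<bar> \<le> 2 * (1/2) ^ m" if "x \<in> {0..1}" for m x
  proof -
    \<comment> \<open>As 3 x - 1 ranges over [-1, 2] and the covers lie in [0, 1], both maxima are
      in [0, 2].\<close>
    have "\<bar>max 0 (3 * x - 1 - qdec (right_cover p m)) - max 0 (qdec (left_cover p m) - (3 * x - 1))\<bar> \<le> 2"
      using cov(1-4)[of m] that ab by (auto simp: max_def abs_if)
    from mult_left_mono[OF this, of "(1/2) ^ m"] show ?thesis
      by (simp add: ramp_def abs_mult mult_ac)
  qed
  have geo: "(\<lambda>m. 2 * (1/2 :: real) ^ (m + M)) sums (4 * (1/2) ^ M)" for M :: nat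
    using sums_mult[OF geometric_sums[of "1/2::real"], of "2 * (1/2) ^ M"] by (simp add: power_add mult_ac)
  have summable: "summable (\<lambda>m. ramp p m x)" if "x \<in> {0..1}" for x
    by (rule summable_comparison_test'[of "\<lambda>m. 2 * (1/2) ^ m" 0])
      (use bound[OF that] sums_summable[OF geo[of 0]] in simp_all)
  show approx: "\<bar>(\<Sum>m<M. ramp p m x) - ramp_sum p x\<bar> \<le> 4 * (1/2) ^ M" if x: "x \<in> {0..1}" for x M
  proof -
    have "ramp_sum p x = (\<Sum>m. ramp p (m + M) x) + (\<Sum>m<M. ramp p m x)"
      using suminf_split_initial_segment[OF summable[OF x], of M] x by (simp add: ramp_sum_def)
    moreover have "norm (\<Sum>m. ramp p (m + M) x) \<le> (\<Sum>m. 2 * (1/2) ^ (m + M))"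
      using bound[OF x] sums_summable[OF geo] by (intro norm_suminf_le) auto
    ultimately show ?thesis
      using sums_unique[OF geo[of M]] by simp
  qed
  have "uniform_limit {0..1} (\<lambda>M x. \<Sum>m<M. ramp p m x) (ramp_sum p) sequentially"
  proof (rule uniform_limitI)
    fix e :: real
    assume "e > 0"
    moreover have "(\<lambda>M. 4 * (1/2 :: real) ^ M) \<longlonglongrightarrow> 0"
      using tendsto_mult_right_zero[OF LIMSEQ_power_zero[of "1/2 :: real"], of 4] by simp
    ultimately have "\<forall>\<^sub>F M in sequentially. 4 * (1/2) ^ M < e"
      by (rule order_tendstoD(2)[rotated])
    then show "\<forall>\<^sub>F M in sequentially. \<forall>x\<in>{0..1}. dist (\<Sum>m<M. ramp p m x) (ramp_sum p x) < e"
      by eventually_elim (auto simp: dist_real_def intro: le_less_trans[OF approx])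
  qed
  moreover have "continuous_on {0..1} (\<lambda>x. \<Sum>m<M. ramp p m x)" for M
    unfolding ramp_def by (intro continuous_intros)
  ultimately show "continuous_on {0..1} (ramp_sum p)"
    by (intro uniform_limit_theorem) auto
  have neg: "ramp_sum p x < 0" if x: "x \<in> {0..1}" "3 * x - 1 < a" for x
  proof -
    obtain i where i: "3 * x - 1 < qdec (left_cover p i)"
      using cov(5)[OF x(2)] by blast
    \<comment> \<open>Left of \<open>a\<close> the argument is below every right cover, so the first
      maximum vanishes.\<close>
    have "ramp p m x = - ((1/2) ^ m * max 0 (qdec (left_cover p m) - (3 * x - 1)))" for m
      using cov(3)[of m] x ab by (simp add: ramp_def max_def)
    then have "0 < (\<Sum>m. - ramp p m x)"
      using i summable[OF x(1)] by (intro suminf_pos2[of _ i] summable_minus) auto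
    then show ?thesis
      using suminf_minus[OF summable[OF x(1)]] x by (simp add: ramp_sum_def)
  qed
  have pos: "0 < ramp_sum p x" if x: "x \<in> {0..1}" "b < 3 * x - 1" for x
  proof -
    obtain i where i: "qdec (right_cover p i) < 3 * x - 1"
      using cov(6)[OF x(2)] by blast
    have "ramp p m x = (1/2) ^ m * max 0 (3 * x - 1 - qdec (right_cover p m))" for m
      using cov(2)[of m] x ab by (simp add: ramp_def max_def)
    then have "0 < (\<Sum>m. ramp p m x)"
      using i summable[OF x(1)] by (intro suminf_pos2[of _ i]) auto
    then show ?thesis
      using x by (simp add: ramp_sum_def)
  qed
  show "ramp_sum p 0 < 0" "0 < ramp_sum p 1"
    using ab by (auto intro: neg pos)
  show "3 * x - 1 \<in> {a..b}" if "x \<in> {0..1}" "ramp_sum p x = 0"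
    using neg[of x] pos[of x] that by (auto simp: not_less[symmetric])
qed

text \<open>The degree is a power of 4 so that the square root in the Bernstein bound is a power of
  2. Degree and number of summands are chosen to keep Bernstein error and tail together below
  2^-n.\<close>

lemma ramp_polynomials:
  obtains K where "computable (\<lambda>p. Some (K p))"
    "\<And>p n x. qpoly (K p n) x = (\<Sum>k\<le>4 ^ (n + 5).
       (\<Sum>m<n + 3. ramp p m (real k / real (4 ^ (n + 5)))) * Bernstein (4 ^ (n + 5)) k x)"
proof -
  define coeff where "coeff p i n = (\<Sum>k<Suc i. (\<Sum>m<n + 3. ramp p m (real k / real (4 ^ (n + 5))))
      * (-1) ^ (i - k) * real (fact (4 ^ (n + 5)))
      / real (fact k * fact (i - k) * fact (4 ^ (n + 5) - i)))" for p i n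
  have left: "comp_nat (\<lambda>p n. left_cover p n)" and right: "comp_nat (\<lambda>p n. right_cover p n)"
    unfolding left_cover_def right_cover_def by (intro comp_intros)+
  have "comp_rat (\<lambda>p e. coeff p (nfst e) (nsnd e))"
    unfolding coeff_def ramp_def by (intro comp_intros comp_nat_compose[OF left] comp_nat_compose[OF right])
  then obtain C where C: "comp_nat C" "\<And>p e. qdec (C p e) = coeff p (nfst e) (nsnd e)"
    by (rule comp_rat_code) blast
  define K where "K p n = list_encode (map (\<lambda>i. C p (prod_encode (i, n))) [0..<Suc (4 ^ (n + 5))])" for p n
  show thesis
  proof
    show "computable (\<lambda>p. Some (K p))"
      unfolding K_def by (intro computable_total comp_intros comp_nat_compose[OF C(1)])
    show "qpoly (K p n) x = (\<Sum>k\<le>4 ^ (n + 5).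
       (\<Sum>m<n + 3. ramp p m (real k / real (4 ^ (n + 5)))) * Bernstein (4 ^ (n + 5)) k x)" for p n x
    proof -
      have "qpoly (K p n) x = (\<Sum>i<Suc (4 ^ (n + 5)). coeff p i n * x ^ i)"
        unfolding qpoly_def K_def Let_def list_encode_inverse length_map length_upt diff_zero
        by (intro sum.cong refl) (simp add: C del: upt_Suc)
      then show ?thesis
        unfolding Bernstein_sum_coefficients coeff_def .
    qed
  qed
qed

text \<open>The outer map only undoes the substitution y = 3 x - 1 and thus works without the
  original name, as strong reducibility demands.\<close>

lemma CI_le_IVT: "sW_le closed_rep unit_rep CI_dom CI_map cfun_rep unit_rep IVT_dom IVT_map"
proof -
  obtain K where K: "computable (\<lambda>p. Some (K p))"
    "\<And>p n x. qpoly (K p n) x = (\<Sum>k\<le>4 ^ (n + 5).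
       (\<Sum>m<n + 3. ramp p m (real k / real (4 ^ (n + 5)))) * Bernstein (4 ^ (n + 5)) k x)"
    by (rule ramp_polynomials) blast
  \<comment> \<open>Reading digit n + 2 absorbs the factor 3: the error becomes at most 3/4 *
    2^-n.\<close>
  have "comp_rat (\<lambda>p n. 3 * qdec (p (n + 2)) - 1)"
    by (intro comp_intros)
  then obtain H where H: "comp_nat H" "\<And>p n. qdec (H p n) = 3 * qdec (p (n + 2)) - 1"
    by (rule comp_rat_code) blast
  have "realizer closed_rep unit_rep CI_dom CI_map
      (\<lambda>p. Option.bind (Option.bind (Some (K p)) G) (\<lambda>q. Some (H q)))"
    if G: "realizer cfun_rep unit_rep IVT_dom IVT_map G" for G
    unfolding realizer_def
  proof (intro allI impI)
    fix p A
    assume "closed_rep p A" "A \<in> CI_dom"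
    then obtain a b where p: "closed_rep p {a..b}" and ab: "0 \<le> a" "a \<le> b" "b \<le> 1" and A: "A = {a..b}"
      by (auto simp: CI_dom_def)
    note ramp = ramp_sum_correct[OF p ab]
    have "\<bar>qpoly (K p n) x - ramp_sum p x\<bar> \<le> (1/2) ^ n" if x: "x \<in> {0..1}" for n x
    proof -
      have "sqrt (real (4 ^ (n + 5))) = 2 ^ (n + 5)"
        using real_sqrt_power[of 4 "n + 5"] by simp
      then have "\<bar>qpoly (K p n) x - (\<Sum>m<n + 3. ramp p m x)\<bar> \<le> 12 / (2 * 2 ^ (n + 5))"
        using Bernstein_Lipschitz[of "4 ^ (n + 5)" "\<lambda>x. \<Sum>m<n + 3. ramp p m x" 12 x] x ramp_partial_Lipschitz
        by (simp add: K(2))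
      \<comment> \<open>Bernstein error and tail add up to 11/16 * 2^-n.\<close>
      moreover have "12 / (2 * 2 ^ (n + 5)) = 3/16 * (1/2 :: real) ^ n" "4 * (1/2) ^ (n + 3) = 1/2 * (1/2 :: real) ^ n"
        by (simp_all add: power_add field_simps)
      moreover have "0 < (1/2 :: real) ^ n"
        by simp
      ultimately show ?thesis
        using ramp(1)[OF x, of "n + 3"] by linarith
    qed
    then have "cfun_rep (K p) (ramp_sum p)"
      using ramp(2) by (simp add: cfun_rep_def) (simp add: ramp_sum_def)
    moreover have "ramp_sum p \<in> IVT_dom"
      using ramp(2-4) by (simp add: IVT_dom_def mult_neg_pos) (simp add: ramp_sum_def)
    ultimately obtain q x where q: "G (K p) = Some q" "unit_rep q x" "x \<in> IVT_map (ramp_sum p)"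
      using G unfolding realizer_def by blast
    then have x: "3 * x - 1 \<in> {a..b}"
      using ramp(5)[of x] by (simp add: IVT_map_def)
    have "\<bar>qdec (H q n) - (3 * x - 1)\<bar> \<le> (1/2) ^ n" for n
    proof -
      have "\<bar>qdec (q (n + 2)) - x\<bar> \<le> (1/2) ^ (n + 2)"
        using q(2) unfolding unit_rep_def by blast
      moreover have "(1/2) ^ (n + 2) = 1/4 * (1/2 :: real) ^ n" "0 < (1/2 :: real) ^ n"
        by (simp_all add: power_add)
      ultimately show ?thesis
        unfolding H(2) by linarith
    qed
    then have "unit_rep (H q) (3 * x - 1)"
      using x ab by (auto simp: unit_rep_def)
    then show "\<exists>q y. Option.bind (Option.bind (Some (K p)) G) (\<lambda>q. Some (H q)) = Some q \<and>
        unit_rep q y \<and> y \<in> CI_map A"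
      using q x A by (auto simp: CI_map_def)
  qed
  then show ?thesis
    using K(1) computable_total[OF H(1)] unfolding sW_le_def by blast
qed

theorem theorem6p2:
  shows "sW_equiv cfun_rep unit_rep IVT_dom IVT_map closed_rep unit_rep CI_dom CI_map"
  using IVT_le_CI CI_le_IVT by (simp add: sW_equiv_def)

end
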